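(* Let $\ell$ be a prime number and $n\ge1$. Then the number $s_{\ell,n}$ of switching equivalence classes in $\mathrm{Alt}_n(\mathbb{Z}/\ell\mathbb{Z})$ equals the number $t_{\ell,n}$ of isomorphism classes of modular Eulerian matrices in $\mathrm{Alt}_n(\mathbb{Z}/\ell\mathbb{Z})$.
   Context: $\mathrm{Alt}_n(\mathbb{Z}/\ell\mathbb{Z})$ is the set of $n\times n$ matrices $M=(m_{ij})$ over $\mathbb{Z}/\ell\mathbb{Z}$ with $m_{ii}=0$ and $m_{ij}+m_{ji}=0$. For $v\in[n]$ let $X_v$ be the matrix with $(X_v)_{iv}=1$ and $(X_v)_{vi}=-1$ for all $i\ne v$ and all other entries $0$; the switching at $v$ is $\mu_v(M)=M+X_v$. $M\cong M'$ means there is $\sigma\in\mathfrak{S}_n$ with $m'_{\sigma(i)\sigma(j)}=m_{ij}$ for all $i,j$. $M,M'$ are switching equivalent if there are positive integers $i_1,\dots,i_n$ with $M'\cong\mu_1^{i_1}\cdots\mu_n^{i_n}(M)$. $M$ is a modular Eulerian matrix if $\sum_{j=1}^n m_{ij}=0$ in $\mathbb{Z}/\ell\mathbb{Z}$ for every $i$. *)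

theory Defs
  imports "HOL-Computational_Algebra.Primes" "HOL-Combinatorics.Permutations"
begin

text \<open>An n x n matrix over Z/lZ is represented as a function nat => nat => int,
  indices 0..n-1, entries the canonical representatives 0..l-1, and value 0 outside
  the index range (so that matrices are extensional objects).\<close>

definition Alt :: "nat \<Rightarrow> nat \<Rightarrow> (nat \<Rightarrow> nat \<Rightarrow> int) set" where
  "Alt l n = {M. (\<forall>i j. (i \<ge> n \<or> j \<ge> n) \<longrightarrow> M i j = 0)
      \<and> (\<forall>i<n. \<forall>j<n. 0 \<le> M i j \<and> M i j < int l)
      \<and> (\<forall>i<n. M i i = 0)
      \<and> (\<forall>i<n. \<forall>j<n. (M i j + M j i) mod int l = 0)}"

definition Xmat :: "nat \<Rightarrow> nat \<Rightarrow> nat \<Rightarrow> int" where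
  "Xmat v i j = (if j = v \<and> i \<noteq> v then 1 else if i = v \<and> j \<noteq> v then -1 else 0)"

definition switch :: "nat \<Rightarrow> nat \<Rightarrow> nat \<Rightarrow> (nat \<Rightarrow> nat \<Rightarrow> int) \<Rightarrow> (nat \<Rightarrow> nat \<Rightarrow> int)" where
  "switch l n v M = (\<lambda>i j. if i < n \<and> j < n then (M i j + Xmat v i j) mod int l else 0)"

definition switch_seq :: "nat \<Rightarrow> nat \<Rightarrow> (nat \<Rightarrow> nat) \<Rightarrow> (nat \<Rightarrow> nat \<Rightarrow> int) \<Rightarrow> (nat \<Rightarrow> nat \<Rightarrow> int)" where
  "switch_seq l n k M = foldr (\<lambda>v. switch l n v ^^ k v) [0..<n] M"

definition mat_iso :: "nat \<Rightarrow> (nat \<Rightarrow> nat \<Rightarrow> int) \<Rightarrow> (nat \<Rightarrow> nat \<Rightarrow> int) \<Rightarrow> bool" where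
  "mat_iso n M M' = (\<exists>\<sigma>. \<sigma> permutes {..<n} \<and> (\<forall>i<n. \<forall>j<n. M' (\<sigma> i) (\<sigma> j) = M i j))"

definition switching_equiv :: "nat \<Rightarrow> nat \<Rightarrow> (nat \<Rightarrow> nat \<Rightarrow> int) \<Rightarrow> (nat \<Rightarrow> nat \<Rightarrow> int) \<Rightarrow> bool" where
  "switching_equiv l n M M' = (\<exists>k. (\<forall>v<n. k v \<ge> 1) \<and> mat_iso n (switch_seq l n k M) M')"

definition Eulerian :: "nat \<Rightarrow> nat \<Rightarrow> (nat \<Rightarrow> nat \<Rightarrow> int) \<Rightarrow> bool" where
  "Eulerian l n M = (\<forall>i<n. (\<Sum>j<n. M i j) mod int l = 0)"

definition s_count :: "nat \<Rightarrow> nat \<Rightarrow> nat" where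
  "s_count l n = card (Alt l n // {(M, M'). M \<in> Alt l n \<and> M' \<in> Alt l n \<and> switching_equiv l n M M'})"

definition t_count :: "nat \<Rightarrow> nat \<Rightarrow> nat" where
  "t_count l n = card ({M \<in> Alt l n. Eulerian l n M} //
     {(M, M'). M \<in> Alt l n \<and> Eulerian l n M \<and> M' \<in> Alt l n \<and> Eulerian l n M' \<and> mat_iso n M M'})"

end

theory Submission
  imports Defs Complex_Main "HOL-Number_Theory.Cong" "HOL-Algebra.Group_Action"
begin

text \<open>
  Switching classes are the orbits of the symmetric group on the quotient of \<open>Alt\<close> by the coboundaries
  \<open>x j - x i\<close>, and the Eulerian matrices are the annihilator of the coboundaries under the
  pairing \<open>\<Sum>i<j. M i j * N i j\<close>, that is, the dual of this quotient. A permutation \<open>\<sigma>\<close> has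
  equally many fixed points on the quotient and on its dual: evaluate the sum of the additive character
  of \<open>\<langle>M - \<sigma>M, N\<rangle>\<close> over all \<open>M\<close> and all Eulerian \<open>N\<close> in both orders. Burnside's lemma then
  equates the numbers of orbits. To avoid the quotient, Burnside's lemma is applied to
  the semidirect product of permutations and coboundaries acting on \<open>Alt\<close>.
\<close>

section \<open>Burnside's lemma for a relation given by an action\<close>

text \<open>This carries \<open>burnside\<close>, which speaks of homomorphisms into
  \<open>BijGroup A\<close>, over to a plain function \<open>act\<close> that obeys the action laws
  on \<open>A\<close>, and to the classes \<open>A // R\<close> that the two counts are defined
  by.\<close>

lemma card_quotient_burnside:
  fixes G (structure) and act :: "'g \<Rightarrow> 'a \<Rightarrow> 'a"
  assumes "group G" and fin: "finite (carrier G)" "finite A"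
    and closed: "\<And>g x. g \<in> carrier G \<Longrightarrow> x \<in> A \<Longrightarrow> act g x \<in> A"
    and mult: "\<And>g h x. g \<in> carrier G \<Longrightarrow> h \<in> carrier G \<Longrightarrow> x \<in> A \<Longrightarrow> act (g \<otimes> h) x = act g (act h x)"
    and one: "\<And>x. x \<in> A \<Longrightarrow> act \<one> x = x"
    and R: "\<And>x y. (x, y) \<in> R \<longleftrightarrow> x \<in> A \<and> (\<exists>g\<in>carrier G. y = act g x)"
  shows "card (A // R) * order G = (\<Sum>g\<in>carrier G. card {x \<in> A. act g x = x})"
proof -
  interpret G: group G by fact
  \<comment> \<open>Elements of \<open>BijGroup A\<close> are extensional functions, hence the
    restriction to \<open>A\<close>.\<close>
  define \<phi> where "\<phi> g = restrict (act g) A" for g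
  have bij: "\<phi> g \<in> Bij A" if g: "g \<in> carrier G" for g
  proof -
    have "bij_betw (act g) A A"
    proof (rule bij_betw_byWitness[where f' = "act (inv g)"])
      show "\<forall>x\<in>A. act (inv g) (act g x) = x" "\<forall>x\<in>A. act g (act (inv g) x) = x"
        using g mult[symmetric] one by simp_all
    qed (use g closed in auto)
    then show ?thesis by (simp add: Bij_def \<phi>_def bij_betw_restrict_eq)
  qed
  have "\<phi> \<in> hom G (BijGroup A)"
  proof (rule homI)
    fix g h assume gh: "g \<in> carrier G" "h \<in> carrier G"
    have "\<phi> (g \<otimes> h) = compose A (\<phi> g) (\<phi> h)"
      using gh mult closed by (auto simp: \<phi>_def compose_def fun_eq_iff)
    then show "\<phi> (g \<otimes> h) = \<phi> g \<otimes>\<^bsub>BijGroup A\<^esub> \<phi> h"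
      using bij gh by (simp add: BijGroup_def)
  qed (simp add: BijGroup_def bij)
  then interpret group_action G A \<phi>
    by (intro group_action.intro group_hom.intro group_hom_axioms.intro group_BijGroup G.is_group)
  \<comment> \<open>Each orbit is the \<open>R\<close>-image of a point, so the set of orbits is
    literally the quotient \<open>A // R\<close>.\<close>
  have "orbit G \<phi> x = R `` {x}" if "x \<in> A" for x
    using that R by (auto simp: orbit_def \<phi>_def)
  then have "orbits G A \<phi> = A // R" by (auto simp: orbits_def quotient_def)
  moreover have "invariants A \<phi> g = {x \<in> A. act g x = x}" for g
    by (auto simp: invariants_def \<phi>_def)
  ultimately show ?thesis using burnside[OF fin] by simp
qed

text \<open>In \<open>HOL-Algebra\<close> the syntax \<open>inv\<close> denotes the group inverse;
  this is the inverse of a function.\<close>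

abbreviation inv' :: "('a \<Rightarrow> 'b) \<Rightarrow> 'b \<Rightarrow> 'a" where
  "inv' \<equiv> Hilbert_Choice.inv"

section \<open>Operations on matrices modulo \<open>l\<close>\<close>

locale alt_matrices =
  fixes l n :: nat
  assumes l_pos: "l > 0"
begin

text \<open>The normal form required by \<open>Alt\<close>; applying it after each operation lets
  identities modulo \<open>l\<close> be stated as equalities of functions.\<close>

definition reduce :: "(nat \<Rightarrow> nat \<Rightarrow> int) \<Rightarrow> nat \<Rightarrow> nat \<Rightarrow> int" where
  "reduce A = (\<lambda>i j. if i < n \<and> j < n then A i j mod int l else 0)"

definition plus_mod :: "(nat \<Rightarrow> nat \<Rightarrow> int) \<Rightarrow> (nat \<Rightarrow> nat \<Rightarrow> int) \<Rightarrow> nat \<Rightarrow> nat \<Rightarrow> int" where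
  "plus_mod M N = reduce (\<lambda>i j. M i j + N i j)"

definition minus_mod :: "(nat \<Rightarrow> nat \<Rightarrow> int) \<Rightarrow> (nat \<Rightarrow> nat \<Rightarrow> int) \<Rightarrow> nat \<Rightarrow> nat \<Rightarrow> int" where
  "minus_mod M N = reduce (\<lambda>i j. M i j - N i j)"

definition relabel :: "(nat \<Rightarrow> nat) \<Rightarrow> (nat \<Rightarrow> nat \<Rightarrow> int) \<Rightarrow> nat \<Rightarrow> nat \<Rightarrow> int" where
  "relabel \<sigma> M = (\<lambda>i j. M (\<sigma> i) (\<sigma> j))"

text \<open>The coboundary of a potential \<open>x\<close> on the vertices. The indicator of
  \<open>v\<close> yields \<open>Xmat v\<close> modulo \<open>l\<close>, so the range is the span of
  the switching matrices.\<close>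

definition cobound :: "(nat \<Rightarrow> int) \<Rightarrow> nat \<Rightarrow> nat \<Rightarrow> int" where
  "cobound x = reduce (\<lambda>i j. x j - x i)"

definition Perms :: "(nat \<Rightarrow> nat) set" where
  "Perms = {\<sigma>. \<sigma> permutes {..<n}}"

definition Eul :: "(nat \<Rightarrow> nat \<Rightarrow> int) set" where
  "Eul = {M \<in> Alt l n. Eulerian l n M}"

definition Pairs :: "(nat \<times> nat) set" where
  "Pairs = {(i, j). i < j \<and> j < n}"

text \<open>Summing only over \<open>i < j\<close> keeps the pairing nondegenerate when \<open>l\<close> is even.\<close>

definition pairing :: "(nat \<Rightarrow> nat \<Rightarrow> int) \<Rightarrow> (nat \<Rightarrow> nat \<Rightarrow> int) \<Rightarrow> int" where
  "pairing M N = (\<Sum>(i, j)\<in>Pairs. M i j * N i j)"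

definition chi :: "int \<Rightarrow> complex" where
  "chi k = cis (2 * pi * of_int k / of_nat l)"

text \<open>The oriented edge from \<open>a\<close> to \<open>b\<close> as a skew integer matrix; it
  is zero for \<open>a = b\<close>, so degenerate edges are covered.\<close>

definition elem_mat :: "nat \<Rightarrow> nat \<Rightarrow> nat \<Rightarrow> nat \<Rightarrow> int" where
  "elem_mat a b i j = of_bool (i = a \<and> j = b) - of_bool (i = b \<and> j = a)"

section \<open>The additive character of the integers modulo \<open>l\<close>\<close>

lemma chi_add: "chi (a + b) = chi a * chi b"
  by (simp add: chi_def cis_mult ring_distribs add_divide_distrib)

text \<open>The character is faithful modulo \<open>l\<close>, since a cosine equals 1 only at
  integer multiples of \<open>2 * pi\<close>. Thus congruences can be tested by character
  values.\<close>

lemma chi_eq_1_iff: "chi k = 1 \<longleftrightarrow> [k = 0] (mod int l)"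
proof
  assume "chi k = 1"
  then have "cos (2 * pi * of_int k / of_nat l) = 1" by (simp add: chi_def complex_eq_iff)
  then obtain m :: int where "2 * pi * of_int k / of_nat l = of_int m * 2 * pi"
    using cos_one_2pi_int by blast
  then have "of_int k = (of_int (m * int l) :: real)" using l_pos by (simp add: field_simps)
  then have "k = m * int l" by linarith
  then show "[k = 0] (mod int l)" by (simp add: cong_0_iff)
next
  assume "[k = 0] (mod int l)"
  then obtain m where m: "k = int l * m" by (auto simp: cong_0_iff)
  then have "2 * pi * of_int k / of_nat l = 2 * pi * of_int m" using l_pos by simp
  then show "chi k = 1" by (simp add: chi_def)
qed

lemma chi_cong:
  assumes "[a = b] (mod int l)" shows "chi a = chi b"
proof -
  have "chi (a - b) = 1" using assms by (simp add: chi_eq_1_iff cong_diff_iff_cong_0)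
  then show ?thesis using chi_add[of "a - b" b] by simp
qed

section \<open>Alternating matrices as a finite additive group\<close>

lemma Alt_mod: "M \<in> Alt l n \<Longrightarrow> M i j mod int l = M i j"
  by (cases "i < n \<and> j < n") (auto simp: Alt_def)

lemma Alt_outside: "M \<in> Alt l n \<Longrightarrow> \<not> (i < n \<and> j < n) \<Longrightarrow> M i j = 0"
  by (auto simp: Alt_def)

lemma Alt_skew: "M \<in> Alt l n \<Longrightarrow> [M i j = - M j i] (mod int l)"
proof -
  assume M: "M \<in> Alt l n"
  have "[M i j + M j i = 0] (mod int l)"
    using M by (cases "i < n \<and> j < n") (auto simp: Alt_def cong_def)
  then show ?thesis by (metis add_uminus_conv_diff cong_diff_iff_cong_0 diff_minus_eq_add)
qed

lemma Alt_diag: "M \<in> Alt l n \<Longrightarrow> M i i = 0"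
  by (cases "i < n") (auto simp: Alt_def)

text \<open>Entries are canonical representatives and vanish outside the range, so congruence within
  the range is equality.\<close>

lemma Alt_eqI:
  assumes "M \<in> Alt l n" "N \<in> Alt l n" "\<And>i j. i < n \<Longrightarrow> j < n \<Longrightarrow> [M i j = N i j] (mod int l)"
  shows "M = N"
proof (intro ext)
  fix i j show "M i j = N i j"
    using assms Alt_mod Alt_outside unfolding cong_def by (cases "i < n \<and> j < n") metis+
qed

text \<open>The diagonal is a separate obligation because for even \<open>l\<close> skewness at
  \<open>i = j\<close> gives only that twice the entry vanishes.\<close>

lemma AltI:
  assumes "\<And>i j. i < n \<Longrightarrow> j < n \<Longrightarrow> [A i j + A j i = 0] (mod int l)"
    and "\<And>i. i < n \<Longrightarrow> [A i i = 0] (mod int l)"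
  shows "reduce A \<in> Alt l n"
  using assms l_pos by (auto simp: Alt_def reduce_def cong_def mod_simps)

lemma reduce_cong: "i < n \<Longrightarrow> j < n \<Longrightarrow> [reduce A i j = A i j] (mod int l)"
  by (simp add: reduce_def cong_def)

lemma plus_mod_in_Alt: assumes "M \<in> Alt l n" "N \<in> Alt l n" shows "plus_mod M N \<in> Alt l n"
  unfolding plus_mod_def
proof (rule AltI)
  fix i j
  have "[M i j + N i j + (M j i + N j i) = - M j i + - N j i + (M j i + N j i)] (mod int l)"
    by (intro cong_add Alt_skew assms cong_refl)
  then show "[M i j + N i j + (M j i + N j i) = 0] (mod int l)" by simp
qed (use assms in \<open>simp add: Alt_diag\<close>)

lemma minus_mod_in_Alt: assumes "M \<in> Alt l n" "N \<in> Alt l n" shows "minus_mod M N \<in> Alt l n"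
  unfolding minus_mod_def
proof (rule AltI)
  fix i j
  have "[M i j - N i j + (M j i - N j i) = - M j i - - N j i + (M j i - N j i)] (mod int l)"
    by (intro cong_add cong_diff Alt_skew assms cong_refl)
  then show "[M i j - N i j + (M j i - N j i) = 0] (mod int l)" by simp
qed (use assms in \<open>simp add: Alt_diag\<close>)

lemma cobound_in_Alt: "cobound x \<in> Alt l n"
  unfolding cobound_def by (rule AltI) auto

lemma range_cobound_Alt: "range cobound \<subseteq> Alt l n"
  using cobound_in_Alt by auto

lemma finite_Alt: "finite (Alt l n)"
proof -
  let ?F = "{f. \<forall>p. (p \<in> {..<n} \<times> {..<n} \<longrightarrow> f p \<in> {0..<int l}) \<and> (p \<notin> {..<n} \<times> {..<n} \<longrightarrow> f p = 0)}"
  have "finite ?F" by (rule finite_set_of_finite_funs) auto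
  moreover have "case_prod ` Alt l n \<subseteq> ?F" by (auto simp: Alt_def)
  ultimately have "finite (case_prod ` Alt l n)" by (rule rev_finite_subset)
  then show ?thesis by (rule finite_imageD) (metis inj_onI curry_case_prod)
qed

lemma plus_mod_cancel: "M \<in> Alt l n \<Longrightarrow> M' \<in> Alt l n \<Longrightarrow> plus_mod M N = plus_mod M' N \<Longrightarrow> M = M'"
proof (rule Alt_eqI)
  fix i j assume ij: "i < n" "j < n" and eq: "plus_mod M N = plus_mod M' N"
  have "plus_mod M N i j = plus_mod M' N i j" using eq by simp
  with ij have "[M i j + N i j = M' i j + N i j] (mod int l)"
    by (simp add: plus_mod_def reduce_def cong_def)
  then show "[M i j = M' i j] (mod int l)" by (simp add: cong_add_rcancel)
qed

section \<open>Sums of characters\<close>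

text \<open>If \<open>f N\<close> differs from 1, translation by \<open>N\<close> permutes the
  finite set \<open>A\<close> and multiplies the sum by \<open>f N\<close>, so the sum is 0.\<close>

lemma character_sum:
  fixes f :: "(nat \<Rightarrow> nat \<Rightarrow> int) \<Rightarrow> complex"
  assumes A: "A \<subseteq> Alt l n" and closed: "\<And>M N. M \<in> A \<Longrightarrow> N \<in> A \<Longrightarrow> plus_mod M N \<in> A"
    and hom: "\<And>M N. M \<in> A \<Longrightarrow> N \<in> A \<Longrightarrow> f (plus_mod M N) = f M * f N"
  shows "(\<Sum>M\<in>A. f M) = (if \<forall>M\<in>A. f M = 1 then of_nat (card A) else 0)"
proof (cases "\<forall>M\<in>A. f M = 1")
  case False
  then obtain N where N: "N \<in> A" "f N \<noteq> 1" by blast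
  have "finite A" using A finite_Alt finite_subset by blast
  moreover have inj: "inj_on (\<lambda>M. plus_mod M N) A" using plus_mod_cancel A by (meson inj_onI subsetD)
  moreover have "(\<lambda>M. plus_mod M N) ` A \<subseteq> A" using closed N by blast
  ultimately have img: "(\<lambda>M. plus_mod M N) ` A = A" by (metis endo_inj_surj)
  have "(\<Sum>M\<in>A. f M) = (\<Sum>M\<in>A. f (plus_mod M N))"
    using sum.reindex[OF inj, of f] img by simp
  also have "\<dots> = (\<Sum>M\<in>A. f M) * f N" using hom N by (simp add: sum_distrib_right)
  finally show ?thesis using N False by auto
qed simp

section \<open>The pairing, its nondegeneracy and its invariance\<close>

lemma finite_Pairs: "finite Pairs"
  by (rule finite_subset[of _ "{..<n} \<times> {..<n}"]) (auto simp: Pairs_def)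

lemma pairing_cong:
  assumes "\<And>i j. i < n \<Longrightarrow> j < n \<Longrightarrow> [M i j = M' i j] (mod int l)"
    and "\<And>i j. i < n \<Longrightarrow> j < n \<Longrightarrow> [N i j = N' i j] (mod int l)"
  shows "[pairing M N = pairing M' N'] (mod int l)"
  unfolding pairing_def by (rule cong_sum) (auto simp: Pairs_def intro!: cong_mult assms)

lemma pairing_commute: "pairing M N = pairing N M"
  by (simp add: pairing_def mult.commute)

lemma pairing_plus_mod: "[pairing (plus_mod M M') N = pairing M N + pairing M' N] (mod int l)"
proof -
  have "[pairing (plus_mod M M') N = pairing (\<lambda>i j. M i j + M' i j) N] (mod int l)"
    unfolding plus_mod_def by (intro pairing_cong reduce_cong cong_refl)
  then show ?thesis by (simp add: pairing_def sum.distrib case_prod_unfold ring_distribs)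
qed

lemma pairing_minus_mod: "[pairing (minus_mod M M') N = pairing M N - pairing M' N] (mod int l)"
proof -
  have "[pairing (minus_mod M M') N = pairing (\<lambda>i j. M i j - M' i j) N] (mod int l)"
    unfolding minus_mod_def by (intro pairing_cong reduce_cong cong_refl)
  then show ?thesis by (simp add: pairing_def sum_subtractf case_prod_unfold left_diff_distrib)
qed

text \<open>For \<open>a < b\<close> a single pair contributes. The opposite orientation follows
  from skewness of both matrices, which for \<open>M\<close> holds only modulo
  \<open>l\<close>.\<close>

lemma pairing_elem_mat:
  assumes M: "M \<in> Alt l n" and "a < n" "b < n"
  shows "[pairing M (elem_mat a b) = M a b] (mod int l)"
proof -
  have less: "pairing M (elem_mat c d) = M c d" if "c < d" "d < n" for c d
  proof -
    have cd: "(c, d) \<in> Pairs" using that by (simp add: Pairs_def)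
    have "pairing M (elem_mat c d) = (\<Sum>p\<in>Pairs. if p = (c, d) then M c d else 0)"
      unfolding pairing_def
    proof (rule sum.cong[OF refl])
      fix p assume "p \<in> Pairs"
      then show "(case p of (i, j) \<Rightarrow> M i j * elem_mat c d i j) = (if p = (c, d) then M c d else 0)"
        using \<open>c < d\<close> by (cases p) (auto simp: elem_mat_def Pairs_def)
    qed
    also have "\<dots> = M c d" using cd finite_Pairs by simp
    finally show ?thesis .
  qed
  consider "a < b" | "a = b" | "b < a" by linarith
  then show ?thesis
  proof cases
    case 1
    show ?thesis unfolding less[OF 1 \<open>b < n\<close>] by (rule cong_refl)
  next
    case 2
    then have "pairing M (elem_mat a b) = 0" by (simp add: pairing_def elem_mat_def)
    then show ?thesis using 2 Alt_diag[OF M] by simp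
  next
    case 3
    have "elem_mat a b i j = - elem_mat b a i j" for i j by (simp add: elem_mat_def)
    then have "pairing M (elem_mat a b) = - pairing M (elem_mat b a)"
      by (simp add: pairing_def sum_negf case_prod_unfold)
    then show ?thesis using cong_sym[OF Alt_skew[OF M, of a b]] less[OF 3 \<open>a < n\<close>] by simp
  qed
qed

lemma reduce_elem_mat_in_Alt: "reduce (elem_mat a b) \<in> Alt l n"
proof (rule AltI)
  fix i j
  have "elem_mat a b i j + elem_mat a b j i = 0" by (simp add: elem_mat_def conj_commute)
  then show "[elem_mat a b i j + elem_mat a b j i = 0] (mod int l)" by simp
qed (simp add: elem_mat_def conj_commute)

lemma pairing_reduce: "[pairing M (reduce A) = pairing M A] (mod int l)"
  by (intro pairing_cong reduce_cong cong_refl)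

text \<open>Nondegeneracy: pairing with the elementary matrices recovers every entry.\<close>

lemma eq_if_pairing_eq:
  assumes "M \<in> Alt l n" "M' \<in> Alt l n" "\<And>N. N \<in> Alt l n \<Longrightarrow> [pairing M N = pairing M' N] (mod int l)"
  shows "M = M'"
proof (rule Alt_eqI[OF assms(1,2)])
  fix a b assume ab: "a < n" "b < n"
  show "[M a b = M' a b] (mod int l)"
    using assms(3)[OF reduce_elem_mat_in_Alt, of a b]
      cong_trans[OF pairing_reduce pairing_elem_mat[OF assms(1) ab]]
      cong_trans[OF pairing_reduce pairing_elem_mat[OF assms(2) ab]]
    by (metis cong_sym cong_trans)
qed

text \<open>A permutation of the vertices permutes unordered pairs. Where it reverses the order of a
  pair, both factors change sign and the product stays the same modulo \<open>l\<close>.\<close>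

lemma pairing_relabel:
  assumes "\<sigma> \<in> Perms" "M \<in> Alt l n" "N \<in> Alt l n"
  shows "[pairing (relabel \<sigma> M) (relabel \<sigma> N) = pairing M N] (mod int l)"
proof -
  \<comment> \<open>The image of a pair, sorted so that it lies in \<open>Pairs\<close>
    again.\<close>
  define s where "s = (\<lambda>(i, j). (min (\<sigma> i) (\<sigma> j), max (\<sigma> i) (\<sigma> j)))"
  have p: "\<sigma> permutes {..<n}" using assms by (simp add: Perms_def)
  have lt: "\<sigma> i < n" if "i < n" for i using permutes_in_image[OF p, of i] that by simp
  have injs: "\<sigma> i = \<sigma> j \<longleftrightarrow> i = j" for i j by (rule inj_eq[OF permutes_inj[OF p]])
  have inj: "inj_on s Pairs"
    by (rule inj_onI) (auto simp: s_def Pairs_def min_def max_def injs split: if_splits)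
  have "s ` Pairs \<subseteq> Pairs"
  proof (rule image_subsetI)
    fix p assume "p \<in> Pairs"
    then obtain i j where "p = (i, j)" "i < j" "j < n" by (auto simp: Pairs_def)
    then show "s p \<in> Pairs"
      using lt[of i] lt[of j] injs[of i j] by (auto simp: s_def Pairs_def min_def max_def)
  qed
  then have img: "s ` Pairs = Pairs" using inj finite_Pairs by (metis endo_inj_surj)
  have "pairing M N = (\<Sum>(i, j)\<in>s ` Pairs. M i j * N i j)" by (simp add: pairing_def img)
  also have "\<dots> = (\<Sum>p\<in>Pairs. case s p of (i, j) \<Rightarrow> M i j * N i j)"
    by (simp add: sum.reindex[OF inj])
  also have "[\<dots> = pairing (relabel \<sigma> M) (relabel \<sigma> N)] (mod int l)"
    unfolding pairing_def
  proof (rule cong_sum)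
    fix p assume "p \<in> Pairs"
    obtain i j where ij: "p = (i, j)" by force
    have "[M (\<sigma> j) (\<sigma> i) * N (\<sigma> j) (\<sigma> i) = (- M (\<sigma> i) (\<sigma> j)) * (- N (\<sigma> i) (\<sigma> j))] (mod int l)"
      using assms by (intro cong_mult Alt_skew)
    then show "[(case s p of (i, j) \<Rightarrow> M i j * N i j) =
        (case p of (i, j) \<Rightarrow> relabel \<sigma> M i j * relabel \<sigma> N i j)] (mod int l)"
      by (auto simp: s_def ij relabel_def min_def max_def)
  qed
  finally show ?thesis by (rule cong_sym)
qed

section \<open>Orthogonality of coboundaries and Eulerian matrices\<close>

text \<open>Summation by parts: up to sign, the adjoint of the coboundary map takes a matrix to its
  row sums.\<close>

lemma pairing_cobound:
  assumes N: "N \<in> Alt l n"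
  shows "[pairing (cobound x) N = - (\<Sum>j<n. x j * (\<Sum>i<n. N j i))] (mod int l)"
proof -
  \<comment> \<open>The square is the upper triangle, its mirror image and the diagonal, where
    \<open>N\<close> vanishes.\<close>
  have split: "{..<n} \<times> {..<n} = Pairs \<union> prod.swap ` Pairs \<union> (\<lambda>i. (i, i)) ` {..<n}"
    by (auto simp: Pairs_def image_iff)
  have "[pairing (cobound x) N = pairing (\<lambda>i j. x j - x i) N] (mod int l)"
    unfolding cobound_def by (intro pairing_cong reduce_cong cong_refl)
  also have "pairing (\<lambda>i j. x j - x i) N = (\<Sum>(i, j)\<in>Pairs. x j * N i j) - (\<Sum>(i, j)\<in>Pairs. x i * N i j)"
    by (simp add: pairing_def sum_subtractf case_prod_unfold left_diff_distrib)
  \<comment> \<open>Skewness turns the terms with \<open>x j\<close> into minus the contribution of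
    the lower triangle, so both sums join to one over the square.\<close>
  also have "[(\<Sum>(i, j)\<in>Pairs. x j * N i j) - (\<Sum>(i, j)\<in>Pairs. x i * N i j) =
      (\<Sum>(i, j)\<in>Pairs. x j * - N j i) - (\<Sum>(i, j)\<in>Pairs. x i * N i j)] (mod int l)"
    by (intro cong_diff[OF cong_sum cong_refl]) (simp only: case_prod_unfold cong_mult[OF cong_refl Alt_skew[OF N]])
  also have "(\<Sum>(i, j)\<in>Pairs. x j * - N j i) - (\<Sum>(i, j)\<in>Pairs. x i * N i j)
      = - (\<Sum>(i, j)\<in>{..<n} \<times> {..<n}. x i * N i j)"
  proof -
    have "(\<Sum>(i, j)\<in>{..<n} \<times> {..<n}. x i * N i j) =
        (\<Sum>(i, j)\<in>Pairs \<union> prod.swap ` Pairs. x i * N i j) + (\<Sum>(i, j)\<in>(\<lambda>i. (i, i)) ` {..<n}. x i * N i j)"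
      unfolding split by (rule sum.union_disjoint) (use finite_Pairs in \<open>auto simp: Pairs_def\<close>)
    also have "(\<Sum>(i, j)\<in>(\<lambda>i. (i, i)) ` {..<n}. x i * N i j) = 0"
      using Alt_diag[OF N] by (intro sum.neutral) auto
    also have "(\<Sum>(i, j)\<in>Pairs \<union> prod.swap ` Pairs. x i * N i j) =
        (\<Sum>(i, j)\<in>Pairs. x i * N i j) + (\<Sum>(i, j)\<in>prod.swap ` Pairs. x i * N i j)"
      by (rule sum.union_disjoint) (use finite_Pairs in \<open>auto simp: Pairs_def\<close>)
    also have "(\<Sum>(i, j)\<in>prod.swap ` Pairs. x i * N i j) = (\<Sum>(i, j)\<in>Pairs. x j * N j i)"
      by (subst sum.reindex) (auto simp: case_prod_unfold)
    finally show ?thesis by (simp add: sum_negf case_prod_unfold)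
  qed
  also have "(\<Sum>(i, j)\<in>{..<n} \<times> {..<n}. x i * N i j) = (\<Sum>j<n. x j * (\<Sum>i<n. N j i))"
    by (simp add: sum.cartesian_product[symmetric] sum_distrib_left)
  finally show ?thesis .
qed

text \<open>The Eulerian matrices are the annihilator of the coboundaries: by
  \<open>pairing_cobound\<close> the pairing is a combination of row sums with weights
  \<open>x\<close>.\<close>

lemma Eul_iff: "N \<in> Eul \<longleftrightarrow> N \<in> Alt l n \<and> (\<forall>x. [pairing (cobound x) N = 0] (mod int l))"
proof (cases "N \<in> Alt l n")
  case N: True
  show ?thesis
  proof
    assume "N \<in> Eul"
    then have row: "[(\<Sum>i<n. N j i) = 0] (mod int l)" if "j < n" for j
      using that by (simp add: Eul_def Eulerian_def cong_def)
    have "[- (\<Sum>j<n. x j * (\<Sum>i<n. N j i)) = - (\<Sum>j<n. x j * 0)] (mod int l)" for x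
      by (subst cong_minus_minus_iff, intro cong_sum cong_mult cong_refl row) simp
    then show "N \<in> Alt l n \<and> (\<forall>x. [pairing (cobound x) N = 0] (mod int l))"
      using N cong_trans[OF pairing_cobound[OF N]] by simp
  next
    assume r: "N \<in> Alt l n \<and> (\<forall>x. [pairing (cobound x) N = 0] (mod int l))"
    have "(\<Sum>i<n. N v i) mod int l = 0" if "v < n" for v
    proof -
      \<comment> \<open>The potential supported at \<open>v\<close> isolates row
        \<open>v\<close>.\<close>
      have "(\<Sum>j<n. of_bool (j = v) * (\<Sum>i<n. N j i)) = (\<Sum>i<n. N v i)"
        using that by (simp add: of_bool_def if_distrib[of "\<lambda>t. t * _"] sum.delta cong: if_cong)
      then have "[- (\<Sum>i<n. N v i) = 0] (mod int l)"
        using cong_trans[OF cong_sym[OF pairing_cobound[OF N, of "\<lambda>j. of_bool (j = v)"]]] r by simp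
      then show ?thesis by (simp add: cong_0_iff)
    qed
    then show "N \<in> Eul" using N by (simp add: Eul_def Eulerian_def)
  qed
qed (simp add: Eul_def)

lemma Eul_subset: "Eul \<subseteq> Alt l n"
  by (auto simp: Eul_def)

lemma Eul_plus_mod: assumes "M \<in> Eul" "N \<in> Eul" shows "plus_mod M N \<in> Eul"
  unfolding Eul_iff
proof (intro conjI allI)
  show "plus_mod M N \<in> Alt l n" using assms plus_mod_in_Alt Eul_subset by blast
  fix x
  have "[pairing (plus_mod M N) (cobound x) = pairing M (cobound x) + pairing N (cobound x)] (mod int l)"
    by (rule pairing_plus_mod)
  also have "[pairing M (cobound x) + pairing N (cobound x) = 0] (mod int l)"
    using assms cong_add[of "pairing M (cobound x)" 0 "int l" "pairing N (cobound x)" 0]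
    by (simp add: Eul_iff pairing_commute[of _ "cobound x"])
  finally show "[pairing (cobound x) (plus_mod M N) = 0] (mod int l)" by (simp add: pairing_commute)
qed

text \<open>Oriented triangles are Eulerian, and orthogonality to the triangles through vertex \<open>0\<close>
  is the cocycle condition \<open>M a b = M 0 b - M 0 a\<close>.\<close>

lemma range_cobound_iff:
  "M \<in> range cobound \<longleftrightarrow> M \<in> Alt l n \<and> (\<forall>N\<in>Eul. [pairing M N = 0] (mod int l))"
proof
  assume "M \<in> range cobound"
  then show "M \<in> Alt l n \<and> (\<forall>N\<in>Eul. [pairing M N = 0] (mod int l))"
    using cobound_in_Alt Eul_iff by auto
next
  assume r: "M \<in> Alt l n \<and> (\<forall>N\<in>Eul. [pairing M N = 0] (mod int l))"
  then have M: "M \<in> Alt l n" by simp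
  \<comment> \<open>Row \<open>0\<close> serves as the potential, normalised to vanish at vertex
    \<open>0\<close>.\<close>
  have "M = cobound (M 0)"
  proof (rule Alt_eqI[OF M cobound_in_Alt])
    fix a b assume ab: "a < n" "b < n"
    then have n: "0 < n" by simp
    \<comment> \<open>The triangle from \<open>0\<close> to \<open>a\<close> to \<open>b\<close> and
      back; it may degenerate, since \<open>elem_mat c c\<close> is zero.\<close>
    define T where "T = (\<lambda>i j. elem_mat 0 a i j + elem_mat a b i j + elem_mat b 0 i j)"
    have T: "reduce T \<in> Alt l n" 
    proof (rule AltI)
      fix i j
      have "T i j + T j i = 0" by (simp add: T_def elem_mat_def conj_commute)
      then show "[T i j + T j i = 0] (mod int l)" by simp
    qed (simp add: T_def elem_mat_def conj_commute)
    \<comment> \<open>An edge contributes \<open>1\<close> at its source and \<open>-1\<close> at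
      its target, so around the closed triangle the row sums cancel.\<close>
    have elem_row: "(\<Sum>j<n. elem_mat c d i j) = of_bool (i = c) - of_bool (i = d)"
      if "c < n" "d < n" for c d i
      using that by (simp add: elem_mat_def sum_subtractf of_bool_conj sum_distrib_left[symmetric] of_bool_def sum.delta)
    have "(\<Sum>j<n. reduce T i j) mod int l = 0" if "i < n" for i
    proof -
      have "(\<Sum>j<n. reduce T i j) mod int l = (\<Sum>j<n. T i j) mod int l"
        using that by (simp add: reduce_def mod_sum_eq)
      also have "(\<Sum>j<n. T i j) = 0"
        using elem_row n ab by (simp add: T_def sum.distrib)
      finally show ?thesis by simp
    qed
    then have "reduce T \<in> Eul" using T by (simp add: Eul_def Eulerian_def)
    then have T0: "[pairing M T = 0] (mod int l)" using r pairing_reduce cong_trans cong_sym by blast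
    have "pairing M T = pairing M (elem_mat 0 a) + pairing M (elem_mat a b) + pairing M (elem_mat b 0)"
      by (simp add: pairing_def T_def sum.distrib case_prod_unfold ring_distribs)
    also have "[\<dots> = M 0 a + M a b + - M 0 b] (mod int l)"
      using n ab M by (intro cong_add cong_trans[OF pairing_elem_mat Alt_skew] pairing_elem_mat)
    finally have "[M 0 a + M a b + - M 0 b = 0] (mod int l)"
      using T0 cong_trans cong_sym by blast
    then have "[M a b - (M 0 b - M 0 a) = 0] (mod int l)" by (simp add: algebra_simps)
    then have "[M a b = M 0 b - M 0 a] (mod int l)" by (simp add: cong_diff_iff_cong_0)
    then show "[M a b = cobound (M 0) a b] (mod int l)"
      using ab by (simp add: cobound_def reduce_def cong_def)
  qed
  then show "M \<in> range cobound" by blast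
qed

section \<open>The number of coboundaries\<close>

lemma plus_mod_cobound: "plus_mod (cobound x) (cobound y) = cobound (\<lambda>i. x i + y i)"
  by (intro ext) (simp add: plus_mod_def cobound_def reduce_def mod_simps, simp add: algebra_simps)

lemma range_cobound_plus_mod: "M \<in> range cobound \<Longrightarrow> N \<in> range cobound \<Longrightarrow> plus_mod M N \<in> range cobound"
  using plus_mod_cobound by auto

lemma chi_pairing_plus_mod: "chi (pairing (plus_mod M M') N) = chi (pairing M N) * chi (pairing M' N)"
  using chi_cong[OF pairing_plus_mod] by (simp add: chi_add)

lemma cobound_zero: "cobound (\<lambda>_. 0) = (\<lambda>i j. 0)"
  by (simp add: cobound_def reduce_def fun_eq_iff)

lemma zero_in_range_cobound: "(\<lambda>i j. 0) \<in> range cobound"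
  using cobound_zero by (metis rangeI)

text \<open>The double character sum is evaluated in both orders. Summing over all \<open>N\<close>
  first leaves only \<open>M = 0\<close>, by nondegeneracy; summing over the coboundaries first
  leaves only the Eulerian \<open>N\<close>.\<close>

lemma card_cobound_Eul: "card (range cobound) * card Eul = card (Alt l n)"
proof -
  let ?S = "\<Sum>M\<in>range cobound. \<Sum>N\<in>Alt l n. chi (pairing M N)"
  have finW: "finite (range cobound)" using finite_subset[OF range_cobound_Alt finite_Alt] .
  have "(\<Sum>N\<in>Alt l n. chi (pairing M N)) = (if M = (\<lambda>i j. 0) then of_nat (card (Alt l n)) else 0)"
    if "M \<in> range cobound" for M
  proof -
    have "(\<forall>N\<in>Alt l n. chi (pairing M N) = 1) \<longleftrightarrow> M = (\<lambda>i j. 0)"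
    proof
      assume "\<forall>N\<in>Alt l n. chi (pairing M N) = 1"
      then show "M = (\<lambda>i j. 0)"
        using that zero_in_range_cobound range_cobound_Alt
        by (intro eq_if_pairing_eq) (auto simp: chi_eq_1_iff pairing_def[of "\<lambda>i j. 0"])
    qed (simp add: pairing_def chi_def)
    then show ?thesis
      using character_sum[OF subset_refl plus_mod_in_Alt, of "\<lambda>N. chi (pairing M N)"]
        chi_pairing_plus_mod[of _ _ M] by (simp add: pairing_commute[of M])
  qed
  then have "?S = of_nat (card (Alt l n))" using finW zero_in_range_cobound by (simp add: sum.delta)
  moreover have "?S = of_nat (card (range cobound) * card Eul)"
  proof -
    have "?S = (\<Sum>N\<in>Alt l n. \<Sum>M\<in>range cobound. chi (pairing M N))" by (rule sum.swap)
    also have "\<dots> = (\<Sum>N\<in>Alt l n. if N \<in> Eul then of_nat (card (range cobound)) else 0)"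
    proof (rule sum.cong[OF refl])
      fix N assume N: "N \<in> Alt l n"
      have "(\<forall>M\<in>range cobound. chi (pairing M N) = 1) \<longleftrightarrow> N \<in> Eul"
        using N by (auto simp: Eul_iff chi_eq_1_iff)
      then show "(\<Sum>M\<in>range cobound. chi (pairing M N)) = (if N \<in> Eul then of_nat (card (range cobound)) else 0)"
        using character_sum[OF range_cobound_Alt range_cobound_plus_mod, of "\<lambda>M. chi (pairing M N)"]
          chi_pairing_plus_mod[of _ _ N] by simp
    qed
    also have "\<dots> = (\<Sum>N\<in>Eul. of_nat (card (range cobound)))"
      by (rule sum.mono_neutral_cong_right) (use finite_Alt Eul_subset in auto)
    finally show ?thesis by (simp add: mult.commute)
  qed
  ultimately show ?thesis using of_nat_eq_iff by metis
qed

section \<open>Relabelling by permutations\<close>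

lemma Perms_lt: "\<sigma> \<in> Perms \<Longrightarrow> \<sigma> i < n \<longleftrightarrow> i < n"
  using permutes_in_image[of \<sigma> "{..<n}" i] by (simp add: Perms_def)

lemma relabel_in_Alt: "\<sigma> \<in> Perms \<Longrightarrow> M \<in> Alt l n \<Longrightarrow> relabel \<sigma> M \<in> Alt l n"
  using Perms_lt[of \<sigma>] by (auto simp: Alt_def relabel_def not_less[symmetric])

lemma relabel_reduce: "\<sigma> \<in> Perms \<Longrightarrow> relabel \<sigma> (reduce A) = reduce (relabel \<sigma> A)"
  by (simp add: relabel_def reduce_def Perms_lt)

lemma relabel_plus_mod: "\<sigma> \<in> Perms \<Longrightarrow> relabel \<sigma> (plus_mod M N) = plus_mod (relabel \<sigma> M) (relabel \<sigma> N)"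
  by (simp add: plus_mod_def relabel_reduce) (simp add: relabel_def)

lemma relabel_cobound: "\<sigma> \<in> Perms \<Longrightarrow> relabel \<sigma> (cobound x) = cobound (x \<circ> \<sigma>)"
  by (simp add: cobound_def relabel_reduce) (simp add: relabel_def)

lemma relabel_comp: "relabel \<sigma> (relabel \<tau> M) = relabel (\<tau> \<circ> \<sigma>) M"
  by (simp add: relabel_def)

lemma Perms_inv: "\<sigma> \<in> Perms \<Longrightarrow> inv' \<sigma> \<in> Perms"
  by (simp add: Perms_def permutes_inv)

lemma Perms_comp: "\<sigma> \<in> Perms \<Longrightarrow> \<tau> \<in> Perms \<Longrightarrow> \<sigma> \<circ> \<tau> \<in> Perms"
  by (simp add: Perms_def permutes_compose)

lemma relabel_inv:
  "\<sigma> \<in> Perms \<Longrightarrow> relabel (inv' \<sigma>) (relabel \<sigma> M) = M"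
  "\<sigma> \<in> Perms \<Longrightarrow> relabel \<sigma> (relabel (inv' \<sigma>) M) = M"
  by (simp_all add: Perms_def relabel_def permutes_inverses)

lemma relabel_in_Eul: assumes s: "\<sigma> \<in> Perms" and M: "M \<in> Eul" shows "relabel \<sigma> M \<in> Eul"
  unfolding Eul_iff
proof (intro conjI allI)
  have MA: "M \<in> Alt l n" using M Eul_subset by blast
  show "relabel \<sigma> M \<in> Alt l n" using relabel_in_Alt s MA .
  fix x
  \<comment> \<open>Each coboundary is the relabelling of another one, so invariance of the pairing
    moves \<open>\<sigma>\<close> off \<open>M\<close>.\<close>
  have "cobound x = relabel \<sigma> (cobound (x \<circ> inv' \<sigma>))"
    using relabel_inv(2)[OF s, of "cobound x"] relabel_cobound[OF Perms_inv[OF s]] by simp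
  then have "[pairing (cobound x) (relabel \<sigma> M) = pairing (cobound (x \<circ> inv' \<sigma>)) M] (mod int l)"
    using pairing_relabel[OF s cobound_in_Alt MA] by metis
  also have "[pairing (cobound (x \<circ> inv' \<sigma>)) M = 0] (mod int l)" using M by (simp add: Eul_iff)
  finally show "[pairing (cobound x) (relabel \<sigma> M) = 0] (mod int l)" .
qed

section \<open>Fixed points on the quotient and on its dual\<close>

text \<open>The sum over Eulerian \<open>N\<close> detects whether \<open>M\<close> is fixed modulo
  coboundaries, and the sum over \<open>M\<close> detects whether \<open>N\<close> is fixed. The
  left count runs over matrices, so each fixed coset counts \<open>card (range cobound)\<close>
  times; by \<open>card_cobound_Eul\<close> this is what the factors \<open>card Eul\<close> and
  \<open>card (Alt l n)\<close> balance.\<close>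

lemma fixed_points_duality:
  assumes s: "\<sigma> \<in> Perms"
  shows "card Eul * card {M \<in> Alt l n. minus_mod M (relabel \<sigma> M) \<in> range cobound}
    = card (Alt l n) * card {N \<in> Eul. relabel \<sigma> N = N}"
proof -
  let ?f = "\<lambda>M N. chi (pairing (minus_mod M (relabel \<sigma> M)) N)"
  let ?S = "\<Sum>M\<in>Alt l n. \<Sum>N\<in>Eul. ?f M N"
  have finE: "finite Eul" using finite_subset[OF Eul_subset finite_Alt] .
  have f: "?f M N = chi (pairing M N - pairing (relabel \<sigma> M) N)" for M N
    by (rule chi_cong[OF pairing_minus_mod])
  have "(\<Sum>N\<in>Eul. ?f M N) = (if minus_mod M (relabel \<sigma> M) \<in> range cobound then of_nat (card Eul) else 0)"
    if M: "M \<in> Alt l n" for M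
  proof -
    have "(\<forall>N\<in>Eul. ?f M N = 1) \<longleftrightarrow> minus_mod M (relabel \<sigma> M) \<in> range cobound"
      using M minus_mod_in_Alt relabel_in_Alt[OF s] unfolding range_cobound_iff by (auto simp: chi_eq_1_iff)
    then show ?thesis
      using character_sum[OF Eul_subset Eul_plus_mod, of "?f M"]
        chi_pairing_plus_mod[of _ _ "minus_mod M (relabel \<sigma> M)"]
      by (simp add: pairing_commute[of "minus_mod M (relabel \<sigma> M)"])
  qed
  then have "?S = (\<Sum>M\<in>Alt l n. if minus_mod M (relabel \<sigma> M) \<in> range cobound then of_nat (card Eul) else 0)"
    by (rule sum.cong[OF refl])
  also have "\<dots> = (\<Sum>M\<in>{M \<in> Alt l n. minus_mod M (relabel \<sigma> M) \<in> range cobound}. of_nat (card Eul))"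
    by (rule sum.inter_filter[symmetric, OF finite_Alt])
  also have "\<dots> = of_nat (card Eul * card {M \<in> Alt l n. minus_mod M (relabel \<sigma> M) \<in> range cobound})"
    by (simp add: mult.commute)
  finally have S1: "?S = of_nat (card Eul * card {M \<in> Alt l n. minus_mod M (relabel \<sigma> M) \<in> range cobound})" .
  have "(\<Sum>M\<in>Alt l n. ?f M N) = (if relabel \<sigma> N = N then of_nat (card (Alt l n)) else 0)"
    if "N \<in> Eul" for N
  proof -
    have N: "N \<in> Alt l n" using that Eul_subset by blast
    have hom: "?f (plus_mod M M') N = ?f M N * ?f M' N" for M M'
    proof -
      have "[pairing (plus_mod M M') N - pairing (relabel \<sigma> (plus_mod M M')) N =
          (pairing M N + pairing M' N) - (pairing (relabel \<sigma> M) N + pairing (relabel \<sigma> M') N)] (mod int l)"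
        unfolding relabel_plus_mod[OF s] by (intro cong_diff pairing_plus_mod)
      also have "(pairing M N + pairing M' N) - (pairing (relabel \<sigma> M) N + pairing (relabel \<sigma> M') N)
          = (pairing M N - pairing (relabel \<sigma> M) N) + (pairing M' N - pairing (relabel \<sigma> M') N)" by simp
      finally show ?thesis unfolding f chi_add[symmetric] by (rule chi_cong)
    qed
    have "(\<forall>M\<in>Alt l n. ?f M N = 1) \<longleftrightarrow> relabel \<sigma> N = N"
    proof
      assume a: "\<forall>M\<in>Alt l n. ?f M N = 1"
      show "relabel \<sigma> N = N"
      \<comment> \<open>With \<open>M'\<close> the preimage of \<open>M\<close> under relabelling,
        invariance gives \<open>pairing M (relabel \<sigma> N)\<close> congruent to
        \<open>pairing M' N\<close>, and the assumption at \<open>M'\<close> gives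
        \<open>pairing M N\<close>.\<close>
      proof (rule eq_if_pairing_eq[OF relabel_in_Alt[OF s N] N])
        fix M assume M: "M \<in> Alt l n"
        define M' where "M' = relabel (inv' \<sigma>) M"
        have M': "M' \<in> Alt l n" "relabel \<sigma> M' = M"
          using relabel_in_Alt[OF Perms_inv[OF s] M] relabel_inv(2)[OF s] by (auto simp: M'_def)
        have "[pairing M (relabel \<sigma> N) = pairing M' N] (mod int l)"
          using pairing_relabel[OF s M'(1) N] M' by simp
        also have "[pairing M' N = pairing M N] (mod int l)"
          using a[unfolded f chi_eq_1_iff cong_diff_iff_cong_0, rule_format, OF M'(1)] M'(2)
          by simp
        finally show "[pairing (relabel \<sigma> N) M = pairing N M] (mod int l)" by (simp add: pairing_commute)
      qed
    next
      assume a: "relabel \<sigma> N = N"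
      show "\<forall>M\<in>Alt l n. ?f M N = 1"
        using cong_sym[OF pairing_relabel[OF s _ N]] a
        by (simp add: f chi_eq_1_iff cong_diff_iff_cong_0)
    qed
    then show ?thesis
      using character_sum[OF subset_refl plus_mod_in_Alt, of "\<lambda>M. ?f M N"] hom by simp
  qed
  then have "(\<Sum>N\<in>Eul. \<Sum>M\<in>Alt l n. ?f M N)
      = (\<Sum>N\<in>Eul. if relabel \<sigma> N = N then of_nat (card (Alt l n)) else 0)"
    by (rule sum.cong[OF refl])
  also have "\<dots> = (\<Sum>N\<in>{N \<in> Eul. relabel \<sigma> N = N}. of_nat (card (Alt l n)))"
    by (rule sum.inter_filter[symmetric, OF finE])
  also have "\<dots> = of_nat (card (Alt l n) * card {N \<in> Eul. relabel \<sigma> N = N})"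
    by (simp add: mult.commute)
  finally have "?S = of_nat (card (Alt l n) * card {N \<in> Eul. relabel \<sigma> N = N})"
    unfolding sum.swap[of _ "Alt l n"] .
  with S1 show ?thesis by (simp only: of_nat_eq_iff)
qed

section \<open>Isomorphism and switching as orbit relations\<close>

text \<open>A witness of \<open>mat_iso\<close> relabels \<open>M'\<close> to \<open>M\<close>;
  inversion, a bijection of \<open>Perms\<close>, turns it around.\<close>

lemma mat_iso_iff:
  assumes "M \<in> Alt l n" "M' \<in> Alt l n"
  shows "mat_iso n M M' \<longleftrightarrow> (\<exists>\<sigma>\<in>Perms. M' = relabel \<sigma> M)"
proof -
  have "(\<forall>i<n. \<forall>j<n. M' (\<sigma> i) (\<sigma> j) = M i j) \<longleftrightarrow> M' = relabel (inv' \<sigma>) M" if "\<sigma> \<in> Perms" for \<sigma>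
  proof -
    have "(\<forall>i<n. \<forall>j<n. M' (\<sigma> i) (\<sigma> j) = M i j) \<longleftrightarrow> relabel \<sigma> M' = M"
    proof
      assume a: "\<forall>i<n. \<forall>j<n. M' (\<sigma> i) (\<sigma> j) = M i j"
      show "relabel \<sigma> M' = M"
        by (rule Alt_eqI[OF relabel_in_Alt[OF that assms(2)] assms(1)]) (simp add: relabel_def a)
    next
      assume "relabel \<sigma> M' = M"
      then show "\<forall>i<n. \<forall>j<n. M' (\<sigma> i) (\<sigma> j) = M i j" by (auto simp only: relabel_def)
    qed
    also have "\<dots> \<longleftrightarrow> M' = relabel (inv' \<sigma>) M"
      using relabel_inv(1)[OF that, of M'] relabel_inv(2)[OF that, of M] by metis
    finally show ?thesis .
  qed
  then have "(\<exists>\<sigma>\<in>Perms. \<forall>i<n. \<forall>j<n. M' (\<sigma> i) (\<sigma> j) = M i j)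
      \<longleftrightarrow> (\<exists>\<sigma>\<in>Perms. M' = relabel (inv' \<sigma>) M)"
    by (rule bex_cong[OF refl])
  then have "mat_iso n M M' \<longleftrightarrow> (\<exists>\<sigma>\<in>Perms. M' = relabel (inv' \<sigma>) M)"
    by (simp only: mat_iso_def Perms_def Bex_def mem_Collect_eq)
  also have "\<dots> \<longleftrightarrow> (\<exists>\<sigma>\<in>Perms. M' = relabel \<sigma> M)"
  proof
    assume "\<exists>\<sigma>\<in>Perms. M' = relabel \<sigma> M"
    then obtain \<sigma> where s: "\<sigma> \<in> Perms" and eq: "M' = relabel \<sigma> M" ..
    have "inv' (inv' \<sigma>) = \<sigma>" using s by (simp add: Perms_def permutes_inv_inv)
    then have "M' = relabel (inv' (inv' \<sigma>)) M" using eq by (simp only:)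
    then show "\<exists>\<sigma>\<in>Perms. M' = relabel (inv' \<sigma>) M" using Perms_inv[OF s] by (rule bexI)
  next
    assume "\<exists>\<sigma>\<in>Perms. M' = relabel (inv' \<sigma>) M"
    then obtain \<sigma> where s: "\<sigma> \<in> Perms" and eq: "M' = relabel (inv' \<sigma>) M" ..
    show "\<exists>\<sigma>\<in>Perms. M' = relabel \<sigma> M" using eq Perms_inv[OF s] by (rule bexI)
  qed
  finally show ?thesis .
qed

lemma plus_mod_zero: "M \<in> Alt l n \<Longrightarrow> plus_mod M (\<lambda>i j. 0) = M"
  using Alt_mod[of M] Alt_outside[of M] by (auto simp: plus_mod_def reduce_def fun_eq_iff)

lemma plus_mod_plus: "plus_mod (plus_mod M A) B = plus_mod M (\<lambda>i j. A i j + B i j)"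
  by (simp add: plus_mod_def reduce_def fun_eq_iff mod_simps add.assoc)

lemma switch_plus_mod:
  assumes "M \<in> Alt l n"
  shows "(switch l n v ^^ k) M = plus_mod M (\<lambda>i j. int k * Xmat v i j)"
proof (induction k)
  case 0
  show ?case using plus_mod_zero[OF assms] by simp
next
  case (Suc k)
  have "(switch l n v ^^ Suc k) M = plus_mod (plus_mod M (\<lambda>i j. int k * Xmat v i j)) (Xmat v)"
    by (simp add: Suc) (simp add: switch_def plus_mod_def reduce_def)
  then show ?case by (simp add: plus_mod_plus distrib_right add.commute)
qed

lemma switch_in_Alt:
  assumes "M \<in> Alt l n" shows "(switch l n v ^^ k) M \<in> Alt l n"
  unfolding switch_plus_mod[OF assms] plus_mod_def
proof (rule AltI)
  fix i j
  have "[M i j + M j i = 0] (mod int l)"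
    using cong_add[OF Alt_skew[OF assms, of i j] cong_refl[of "M j i"]] by simp
  moreover have "Xmat v i j = - Xmat v j i" by (auto simp: Xmat_def)
  ultimately show "[M i j + int k * Xmat v i j + (M j i + int k * Xmat v j i) = 0] (mod int l)"
    by (simp add: algebra_simps)
qed (simp add: Alt_diag[OF assms] Xmat_def)

text \<open>Switchings add up, and the combination of the \<open>Xmat v\<close> with weights
  \<open>k v\<close> has entry \<open>k j - k i\<close>.\<close>

lemma switch_seq_eq:
  assumes "M \<in> Alt l n"
  shows "switch_seq l n k M = plus_mod M (cobound (\<lambda>i. int (k i)))"
proof -
  \<comment> \<open>Membership in \<open>Alt\<close> is part of the induction because
    \<open>switch_plus_mod\<close> requires it of the intermediate matrix.\<close>
  have "foldr (\<lambda>v. switch l n v ^^ k v) vs M \<in> Alt l n \<and>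
      foldr (\<lambda>v. switch l n v ^^ k v) vs M = plus_mod M (\<lambda>i j. \<Sum>v\<leftarrow>vs. int (k v) * Xmat v i j)" for vs
  proof (induction vs)
    case Nil
    show ?case using assms plus_mod_zero[OF assms] by simp
  next
    case (Cons v vs)
    let ?F = "foldr (\<lambda>v. switch l n v ^^ k v) vs M"
    have "(switch l n v ^^ k v) ?F = plus_mod ?F (\<lambda>i j. int (k v) * Xmat v i j)"
      using switch_plus_mod Cons by blast
    also have "\<dots> = plus_mod M (\<lambda>i j. \<Sum>v\<leftarrow>v # vs. int (k v) * Xmat v i j)"
      by (subst conjunct2[OF Cons]) (simp add: plus_mod_plus add.commute)
    finally show ?case using switch_in_Alt[OF conjunct1[OF Cons], where k = "k v" and v = v] by simp
  qed
  then have "switch_seq l n k M = plus_mod M (\<lambda>i j. \<Sum>v\<leftarrow>[0..<n]. int (k v) * Xmat v i j)"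
    unfolding switch_seq_def by blast
  moreover have "(\<Sum>v\<leftarrow>[0..<n]. int (k v) * Xmat v i j) = int (k j) - int (k i)" if "i < n" "j < n" for i j
  proof -
    have "(\<Sum>v\<leftarrow>[0..<n]. int (k v) * Xmat v i j) = (\<Sum>v<n. int (k v) * Xmat v i j)"
      by (simp add: interv_sum_list_conv_sum_set_nat atLeast0LessThan)
    also have "\<dots> = (\<Sum>v<n. (if v = j then int (k v) else 0) - (if v = i then int (k v) else 0))"
      by (rule sum.cong) (auto simp: Xmat_def)
    also have "\<dots> = int (k j) - int (k i)" using that by (simp add: sum_subtractf sum.delta)
    finally show ?thesis .
  qed
  ultimately show ?thesis by (simp add: plus_mod_def reduce_def cobound_def fun_eq_iff mod_simps)
qed

lemma switching_equiv_iff: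
  assumes M: "M \<in> Alt l n" and M': "M' \<in> Alt l n"
  shows "switching_equiv l n M M' \<longleftrightarrow>
    (\<exists>(\<sigma>, w)\<in>Perms \<times> range cobound. M' = plus_mod (relabel \<sigma> M) w)"
proof
  assume "switching_equiv l n M M'"
  then obtain k where "mat_iso n (plus_mod M (cobound (\<lambda>i. int (k i)))) M'"
    using switch_seq_eq[OF M] by (auto simp: switching_equiv_def)
  then obtain \<sigma> where "\<sigma> \<in> Perms" "M' = relabel \<sigma> (plus_mod M (cobound (\<lambda>i. int (k i))))"
    using mat_iso_iff[OF plus_mod_in_Alt[OF M cobound_in_Alt] M'] by blast
  then show "\<exists>(\<sigma>, w)\<in>Perms \<times> range cobound. M' = plus_mod (relabel \<sigma> M) w"
    using relabel_plus_mod relabel_cobound by (intro bexI[of _ "(\<sigma>, relabel \<sigma> (cobound (\<lambda>i. int (k i))))"]) auto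
next
  assume "\<exists>(\<sigma>, w)\<in>Perms \<times> range cobound. M' = plus_mod (relabel \<sigma> M) w"
  then obtain \<sigma> x where s: "\<sigma> \<in> Perms" and eq: "M' = plus_mod (relabel \<sigma> M) (cobound x)" by blast
  \<comment> \<open>Switching comes before relabelling, so the potential is read through the inverse
    of \<open>\<sigma>\<close>. Adding \<open>l\<close> makes the exponents positive without
    changing them modulo \<open>l\<close>.\<close>
  define k where "k v = nat (x (inv' \<sigma> v) mod int l) + l" for v
  have k1: "k v \<ge> 1" for v using l_pos by (simp add: k_def)
  have "cobound (\<lambda>i. int (k i)) = cobound (x \<circ> inv' \<sigma>)"
    using l_pos by (auto simp: cobound_def reduce_def k_def fun_eq_iff mod_simps)
  then have "relabel \<sigma> (cobound (\<lambda>i. int (k i))) = cobound x"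
    using relabel_inv(2)[OF s, of "cobound x"] relabel_cobound[OF Perms_inv[OF s]] by simp
  then have "M' = relabel \<sigma> (switch_seq l n k M)"
    using eq relabel_plus_mod[OF s] switch_seq_eq[OF M] by simp
  moreover have "switch_seq l n k M \<in> Alt l n"
    using switch_seq_eq[OF M] plus_mod_in_Alt[OF M cobound_in_Alt] by simp
  ultimately show "switching_equiv l n M M'"
    using mat_iso_iff[OF _ M'] s k1 unfolding switching_equiv_def by blast
qed

section \<open>Orbit counts\<close>

lemma finite_Perms: "finite Perms"
  by (simp add: Perms_def finite_permutations)

text \<open>The products are chosen so that relabelling, which precomposes with \<open>\<sigma>\<close>, is a left action.\<close>

definition perm_group :: "(nat \<Rightarrow> nat) monoid" where
  "perm_group = \<lparr>carrier = Perms, mult = (\<lambda>\<sigma> \<tau>. \<tau> \<circ> \<sigma>), one = id\<rparr>"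

definition switching_group :: "((nat \<Rightarrow> nat) \<times> (nat \<Rightarrow> nat \<Rightarrow> int)) monoid" where
  "switching_group = \<lparr>carrier = Perms \<times> range cobound,
    mult = (\<lambda>(\<sigma>, w) (\<tau>, u). (\<tau> \<circ> \<sigma>, plus_mod (relabel \<sigma> u) w)), one = (id, \<lambda>i j. 0)\<rparr>"

lemma Perms_id: "id \<in> Perms"
  by (simp add: Perms_def permutes_id)

lemma group_perm_group: "group perm_group"
proof (rule groupI)
  fix \<sigma> assume "\<sigma> \<in> carrier perm_group"
  then show "\<exists>\<tau>\<in>carrier perm_group. \<tau> \<otimes>\<^bsub>perm_group\<^esub> \<sigma> = \<one>\<^bsub>perm_group\<^esub>"
    using Perms_inv by (intro bexI[of _ "inv' \<sigma>"]) (auto simp: perm_group_def Perms_def permutes_inv_o)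
qed (auto simp: perm_group_def Perms_comp Perms_id comp_assoc)

lemma relabel_in_range_cobound: "\<sigma> \<in> Perms \<Longrightarrow> w \<in> range cobound \<Longrightarrow> relabel \<sigma> w \<in> range cobound"
  using relabel_cobound by auto

lemma relabel_id: "relabel id M = M"
  by (simp add: relabel_def)

lemma plus_mod_assoc: "plus_mod (plus_mod M N) K = plus_mod M (plus_mod N K)"
  by (auto simp: plus_mod_def reduce_def fun_eq_iff mod_simps add.assoc)

lemma group_switching_group: "group switching_group"
proof (rule groupI)
  fix g assume "g \<in> carrier switching_group"
  then obtain \<sigma> x where g: "g = (\<sigma>, cobound x)" and s: "\<sigma> \<in> Perms"
    by (auto simp: switching_group_def)
  \<comment> \<open>In the left inverse of \<open>(\<sigma>, cobound x)\<close> the second component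
    must cancel \<open>cobound x\<close> after its relabelling by the inverse of
    \<open>\<sigma>\<close>.\<close>
  have "plus_mod (cobound (x \<circ> inv' \<sigma>)) (cobound (- x \<circ> inv' \<sigma>)) = (\<lambda>i j. 0)"
    by (auto simp: plus_mod_cobound cobound_zero)
  then show "\<exists>h\<in>carrier switching_group. h \<otimes>\<^bsub>switching_group\<^esub> g = \<one>\<^bsub>switching_group\<^esub>"
    using s Perms_inv[OF s]
    by (intro bexI[of _ "(inv' \<sigma>, cobound (- x \<circ> inv' \<sigma>))"])
      (auto simp: switching_group_def g relabel_cobound Perms_def permutes_inv_o)
next
  fix g assume "g \<in> carrier switching_group"
  then show "\<one>\<^bsub>switching_group\<^esub> \<otimes>\<^bsub>switching_group\<^esub> g = g"
    using cobound_in_Alt by (auto simp: switching_group_def relabel_id plus_mod_zero)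
qed (auto simp: switching_group_def Perms_comp Perms_id comp_assoc relabel_comp[symmetric]
    relabel_plus_mod plus_mod_assoc zero_in_range_cobound intro!: range_cobound_plus_mod relabel_in_range_cobound)

lemma t_count_eq: "t_count l n * card Perms = (\<Sum>\<sigma>\<in>Perms. card {N \<in> Eul. relabel \<sigma> N = N})"
proof -
  let ?R = "{(M, M'). M \<in> Alt l n \<and> Eulerian l n M \<and> M' \<in> Alt l n \<and> Eulerian l n M' \<and> mat_iso n M M'}"
  have R: "(M, M') \<in> ?R \<longleftrightarrow> M \<in> Eul \<and> (\<exists>\<sigma>\<in>carrier perm_group. M' = relabel \<sigma> M)" for M M'
    using mat_iso_iff[of M M'] relabel_in_Eul[of _ M] by (auto simp: Eul_def perm_group_def)
  have "card (Eul // ?R) * order perm_group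
      = (\<Sum>\<sigma>\<in>carrier perm_group. card {N \<in> Eul. relabel \<sigma> N = N})"
    by (rule card_quotient_burnside[OF group_perm_group])
      (use R finite_Perms finite_subset[OF Eul_subset finite_Alt] in
        \<open>auto simp: perm_group_def relabel_in_Eul relabel_comp relabel_id\<close>)
  then show ?thesis by (simp add: t_count_def Eul_def perm_group_def order_def)
qed

text \<open>Burnside's lemma gives a sum over pairs \<open>(\<sigma>, w)\<close>. For given
  \<open>\<sigma>\<close> a matrix \<open>M\<close> is fixed by exactly one such pair if its
  difference from \<open>relabel \<sigma> M\<close> is a coboundary, and by none otherwise.\<close>

lemma s_count_eq:
  "s_count l n * (card Perms * card (range cobound))
    = (\<Sum>\<sigma>\<in>Perms. card {M \<in> Alt l n. minus_mod M (relabel \<sigma> M) \<in> range cobound})"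
proof -
  let ?W = "range cobound"
  let ?R = "{(M, M'). M \<in> Alt l n \<and> M' \<in> Alt l n \<and> switching_equiv l n M M'}"
  let ?act = "\<lambda>(\<sigma>, w) M. plus_mod (relabel \<sigma> M) w"
  have finW: "finite ?W" using finite_subset[OF range_cobound_Alt finite_Alt] .
  have W: "w \<in> ?W \<Longrightarrow> w \<in> Alt l n" for w using range_cobound_Alt by blast
  have closed: "?act g M \<in> Alt l n" if "g \<in> Perms \<times> ?W" "M \<in> Alt l n" for g M
    using that W relabel_in_Alt plus_mod_in_Alt by auto
  have R: "(M, M') \<in> ?R \<longleftrightarrow> M \<in> Alt l n \<and> (\<exists>g\<in>carrier switching_group. M' = ?act g M)" for M M'
  proof -
    have "switching_equiv l n M M' \<longleftrightarrow> (\<exists>g\<in>carrier switching_group. M' = ?act g M)"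
      if "M \<in> Alt l n" "M' \<in> Alt l n"
      unfolding switching_equiv_iff[OF that] by (simp add: switching_group_def case_prod_unfold)
    moreover have "?act g M \<in> Alt l n" if "g \<in> carrier switching_group" "M \<in> Alt l n" for g
      using closed that by (simp add: switching_group_def)
    ultimately show ?thesis unfolding mem_Collect_eq prod.case by metis
  qed
  have "card (Alt l n // ?R) * order switching_group
      = (\<Sum>g\<in>carrier switching_group. card {M \<in> Alt l n. ?act g M = M})"
    by (rule card_quotient_burnside[OF group_switching_group _ finite_Alt _ _ _ R])
      (use finite_Perms finW closed in
        \<open>auto simp: switching_group_def relabel_comp[symmetric] relabel_plus_mod plus_mod_assoc
          relabel_id plus_mod_zero\<close>)
  then have "s_count l n * (card Perms * card ?W)
      = (\<Sum>g\<in>Perms \<times> ?W. card {M \<in> Alt l n. ?act g M = M})"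
    by (simp add: s_count_def switching_group_def order_def card_cartesian_product)
  also have "\<dots> = (\<Sum>\<sigma>\<in>Perms. \<Sum>w\<in>?W. card {M \<in> Alt l n. plus_mod (relabel \<sigma> M) w = M})"
    by (simp add: sum.cartesian_product case_prod_unfold)
  also have "\<dots> = (\<Sum>\<sigma>\<in>Perms. card {M \<in> Alt l n. minus_mod M (relabel \<sigma> M) \<in> ?W})"
  proof (rule sum.cong[OF refl])
    fix \<sigma> assume s: "\<sigma> \<in> Perms"
    have eq: "plus_mod (relabel \<sigma> M) w = M \<longleftrightarrow> minus_mod M (relabel \<sigma> M) = w"
      if "M \<in> Alt l n" "w \<in> ?W" for M w
    proof
      assume a: "plus_mod (relabel \<sigma> M) w = M"
      have "minus_mod (plus_mod (relabel \<sigma> M) w) (relabel \<sigma> M) = w"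
        using Alt_mod[OF W[OF that(2)]] Alt_outside[OF W[OF that(2)]]
        by (auto simp: minus_mod_def plus_mod_def reduce_def fun_eq_iff mod_simps)
      then show "minus_mod M (relabel \<sigma> M) = w" using a by simp
    next
      assume a: "minus_mod M (relabel \<sigma> M) = w"
      have "plus_mod (relabel \<sigma> M) (minus_mod M (relabel \<sigma> M)) = M"
        using Alt_mod[OF that(1)] Alt_outside[OF that(1)]
        by (auto simp: minus_mod_def plus_mod_def reduce_def fun_eq_iff mod_simps)
      then show "plus_mod (relabel \<sigma> M) w = M" using a by simp
    qed
    have "(\<Sum>w\<in>?W. card {M \<in> Alt l n. plus_mod (relabel \<sigma> M) w = M})
        = (\<Sum>w\<in>?W. card {M \<in> {M \<in> Alt l n. minus_mod M (relabel \<sigma> M) \<in> ?W}. minus_mod M (relabel \<sigma> M) = w})"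
      by (intro sum.cong refl arg_cong[where f = card]) (use eq in auto)
    \<comment> \<open>The sets for the various \<open>w\<close> are the fibres of the difference
      map.\<close>
    also have "\<dots> = card {M \<in> Alt l n. minus_mod M (relabel \<sigma> M) \<in> ?W}"
      using sum.group[of "{M \<in> Alt l n. minus_mod M (relabel \<sigma> M) \<in> ?W}" ?W "\<lambda>M. minus_mod M (relabel \<sigma> M)" "\<lambda>_. 1::nat"]
        finite_Alt finW by auto
    finally show "(\<Sum>w\<in>?W. card {M \<in> Alt l n. plus_mod (relabel \<sigma> M) w = M})
        = card {M \<in> Alt l n. minus_mod M (relabel \<sigma> M) \<in> ?W}" .
  qed
  finally show ?thesis .
qed

text \<open>After multiplication by \<open>card Eul\<close> the two Burnside sums agree term by term
  by \<open>fixed_points_duality\<close>; the common nonzero factor is then cancelled.\<close>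

lemma s_count_eq_t_count: "s_count l n = t_count l n"
proof -
  have "s_count l n * (card Perms * card (Alt l n))
      = card Eul * (s_count l n * (card Perms * card (range cobound)))"
    by (simp add: card_cobound_Eul[symmetric])
  also have "\<dots> = card (Alt l n) * (t_count l n * card Perms)"
    unfolding s_count_eq t_count_eq sum_distrib_left
    using fixed_points_duality by simp
  finally have "s_count l n * (card Perms * card (Alt l n)) = t_count l n * (card Perms * card (Alt l n))"
    by (simp only: mult_ac)
  moreover have "card Perms * card (Alt l n) \<noteq> 0"
    using finite_Perms Perms_id finite_Alt cobound_in_Alt by auto
  ultimately show ?thesis by (metis mult_cancel2)
qed

end

theorem theorem4p7:
  fixes l n :: nat
  assumes "prime l" and "n \<ge> 1"
  shows "s_count l n = t_count l n"
proof -
  interpret alt_matrices l n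
    using assms(1) by unfold_locales (simp add: prime_gt_0_nat)
  show ?thesis by (rule s_count_eq_t_count)
qed

end
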